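(* The functor $\hat{H}\colon\mathsf{Plas}\to\mathsf{Mod}_{\mathbb{F}_1}$ is fully faithful.
   Context: Plasmas. For a set $M$, $\mathcal{P}(M)$ denotes its power set. A plasma is a triple $(M,\boxplus,e)$ with $M$ a set, $\boxplus\colon M\times M\to\mathcal{P}(M)$ a function and $e\in M$, such that $a\in e\boxplus a$ for all $a\in M$ and $a\boxplus b=b\boxplus a$ for all $a,b\in M$. A morphism $(M,\boxplus,e)\to(M',\star,e')$ is a function $f\colon M\to M'$ with $f(e)=e'$ and $f(a\boxplus b)\subseteq f(a)\star f(b)$ for all $a,b$. These form the category $\mathsf{Plas}$. $\mathbb{F}_1$-modules. $\mathsf{Fin}_\ast$ is the category whose objects are the pointed sets $\langle n\rangle=\{0,1,\ldots,n\}$, $n\ge 0$, with basepoint $0$, and whose morphisms are pointed functions; $\mathsf{Set}_\ast$ is the category of pointed sets. An $\mathbb{F}_1$-module is a functor $X\colon\mathsf{Fin}_\ast\to\mathsf{Set}_\ast$ such that $X(\langle 0\rangle)$ is a singleton; $\mathsf{Mod}_{\mathbb{F}_1}$ is the category of these and natural transformations. The functor $\hat{H}$ (plasmic nerve). Write $[n]=\{1,\ldots,n\}$. For a plasma $(M,\boxplus,0)$, $$\hat{H}M_n=\{(x_S)_{S\subseteq[n]}: x_S\in M,\ x_\varnothing=0,\ x_{S\cup T}\in x_S\boxplus x_T\text{ whenever }S\cap T=\varnothing\},$$ pointed by the family that is constantly $0$. A morphism $\phi\colon\langle n\rangle\to\langle m\rangle$ acts by $(x_S)_{S\subseteq[n]}\mapsto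 (x_{\phi^{-1}(T)})_{T\subseteq[m]}$. A plasma morphism $f\colon M\to M'$ induces $(x_S)_S\mapsto (f(x_S))_S$. *)

theory Defs
  imports "HOL-Library.FuncSet"
begin

section \<open>Categories and functors\<close>

text \<open>Hom-sets are indexed by source and target and need not be disjoint, so composition takes the
  three objects as arguments: \<open>Cmp C X Y Z g f\<close> is \<open>g \<circ> f\<close> for \<open>f : X \<rightarrow> Y\<close>, \<open>g : Y \<rightarrow> Z\<close>.\<close>

record ('o, 'm) category =
  Obj :: "'o set"
  Hom :: "'o \<Rightarrow> 'o \<Rightarrow> 'm set"
  Idt :: "'o \<Rightarrow> 'm"
  Cmp :: "'o \<Rightarrow> 'o \<Rightarrow> 'o \<Rightarrow> 'm \<Rightarrow> 'm \<Rightarrow> 'm"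

locale category =
  fixes C :: "('o, 'm) category"
  assumes Idt_in_Hom: "X \<in> Obj C \<Longrightarrow> Idt C X \<in> Hom C X X"
    and Cmp_in_Hom:
      "\<lbrakk>X \<in> Obj C; Y \<in> Obj C; Z \<in> Obj C; f \<in> Hom C X Y; g \<in> Hom C Y Z\<rbrakk>
        \<Longrightarrow> Cmp C X Y Z g f \<in> Hom C X Z"
    and Cmp_Idt_left:
      "\<lbrakk>X \<in> Obj C; Y \<in> Obj C; f \<in> Hom C X Y\<rbrakk> \<Longrightarrow> Cmp C X Y Y (Idt C Y) f = f"
    and Cmp_Idt_right:
      "\<lbrakk>X \<in> Obj C; Y \<in> Obj C; f \<in> Hom C X Y\<rbrakk> \<Longrightarrow> Cmp C X X Y f (Idt C X) = f"
    and Cmp_assoc: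
      "\<lbrakk>W \<in> Obj C; X \<in> Obj C; Y \<in> Obj C; Z \<in> Obj C;
        f \<in> Hom C W X; g \<in> Hom C X Y; h \<in> Hom C Y Z\<rbrakk>
        \<Longrightarrow> Cmp C W Y Z h (Cmp C W X Y g f) = Cmp C W X Z (Cmp C X Y Z h g) f"

record ('o, 'm, 'p, 'n) cfunctor =
  fob :: "'o \<Rightarrow> 'p"
  fmor :: "'o \<Rightarrow> 'o \<Rightarrow> 'm \<Rightarrow> 'n"

text \<open>The extensional function spaces fix the values outside the objects and hom-sets of the
  source, so that functors are equal iff they agree on objects and morphisms.\<close>

locale cfunctor = C: category C + D: category D
  for C :: "('o, 'm) category" and D :: "('p, 'n) category" +
  fixes F :: "('o, 'm, 'p, 'n) cfunctor"
  assumes fob_type: "fob F \<in> Obj C \<rightarrow>\<^sub>E Obj D"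
    and fmor_type:
      "fmor F \<in> (\<Pi>\<^sub>E X\<in>Obj C. \<Pi>\<^sub>E Y\<in>Obj C. Hom C X Y \<rightarrow>\<^sub>E Hom D (fob F X) (fob F Y))"
    and fmor_Idt: "X \<in> Obj C \<Longrightarrow> fmor F X X (Idt C X) = Idt D (fob F X)"
    and fmor_Cmp:
      "\<lbrakk>X \<in> Obj C; Y \<in> Obj C; Z \<in> Obj C; f \<in> Hom C X Y; g \<in> Hom C Y Z\<rbrakk>
        \<Longrightarrow> fmor F X Z (Cmp C X Y Z g f)
            = Cmp D (fob F X) (fob F Y) (fob F Z) (fmor F Y Z g) (fmor F X Y f)"

locale fully_faithful_functor = cfunctor +
  assumes fmor_bij:
    "\<lbrakk>X \<in> Obj C; Y \<in> Obj C\<rbrakk>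
      \<Longrightarrow> bij_betw (fmor F X Y) (Hom C X Y) (Hom D (fob F X) (fob F Y))"

definition full_subcategory :: "('o, 'm) category \<Rightarrow> ('o \<Rightarrow> bool) \<Rightarrow> ('o, 'm) category" where
  "full_subcategory C P = C\<lparr>Obj := {X \<in> Obj C. P X}\<rparr>"

definition nat_transformations ::
  "('o, 'm) category \<Rightarrow> ('p, 'n) category \<Rightarrow> ('o, 'm, 'p, 'n) cfunctor \<Rightarrow>
    ('o, 'm, 'p, 'n) cfunctor \<Rightarrow> ('o \<Rightarrow> 'n) set" where
  "nat_transformations C D F G =
    {\<alpha> \<in> (\<Pi>\<^sub>E X\<in>Obj C. Hom D (fob F X) (fob G X)).
      \<forall>X\<in>Obj C. \<forall>Y\<in>Obj C. \<forall>f\<in>Hom C X Y.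
        Cmp D (fob F X) (fob F Y) (fob G Y) (\<alpha> Y) (fmor F X Y f)
        = Cmp D (fob F X) (fob G X) (fob G Y) (fmor G X Y f) (\<alpha> X)}"

definition functor_category ::
  "('o, 'm) category \<Rightarrow> ('p, 'n) category \<Rightarrow> (('o, 'm, 'p, 'n) cfunctor, 'o \<Rightarrow> 'n) category" where
  "functor_category C D =
    \<lparr>Obj = {F. cfunctor C D F},
     Hom = nat_transformations C D,
     Idt = (\<lambda>F. \<lambda>X\<in>Obj C. Idt D (fob F X)),
     Cmp = (\<lambda>F G H \<beta> \<alpha>. \<lambda>X\<in>Obj C. Cmp D (fob F X) (fob G X) (fob H X) (\<beta> X) (\<alpha> X))\<rparr>"


section \<open>Pointed sets and \<open>\<F>\<^sub>1\<close>-modules\<close>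

text \<open>A pointed set \<open>(A, a)\<close> has its elements in the type \<open>'a\<close>, which serves as the universe;
  likewise for plasmas below.\<close>

type_synonym 'a pointed = "'a set \<times> 'a"

definition Set_pt :: "('a pointed, 'a \<Rightarrow> 'a) category" where
  "Set_pt =
    \<lparr>Obj = {(A, a). a \<in> A},
     Hom = (\<lambda>(A, a) (B, b). {f \<in> A \<rightarrow>\<^sub>E B. f a = b}),
     Idt = (\<lambda>(A, a). \<lambda>x\<in>A. x),
     Cmp = (\<lambda>(A, a) Y Z g f. compose A g f)\<rparr>"

text \<open>The object \<open>n\<close> stands for the pointed set \<open>{0, \<dots>, n}\<close>.\<close>

definition Fin_pt :: "(nat, nat \<Rightarrow> nat) category" where
  "Fin_pt =
    \<lparr>Obj = UNIV,
     Hom = (\<lambda>n m. Hom Set_pt ({..n}, 0) ({..m}, 0)),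
     Idt = (\<lambda>n. Idt Set_pt ({..n}, 0)),
     Cmp = (\<lambda>n m k. Cmp Set_pt ({..n}, 0) ({..m}, 0) ({..k}, 0))\<rparr>"

type_synonym 'a F1_functor = "(nat, nat \<Rightarrow> nat, 'a pointed, 'a \<Rightarrow> 'a) cfunctor"

definition Mod_F1 :: "('a F1_functor, nat \<Rightarrow> 'a \<Rightarrow> 'a) category" where
  "Mod_F1 = full_subcategory (functor_category Fin_pt Set_pt) (\<lambda>X. is_singleton (fst (fob X 0)))"


section \<open>Plasmas\<close>

record 'a plasma =
  pcarrier :: "'a set"
  padd :: "'a \<Rightarrow> 'a \<Rightarrow> 'a set"
  pzero :: 'a

locale plasma =
  fixes M :: "'a plasma"
  assumes padd_type: "padd M \<in> pcarrier M \<rightarrow>\<^sub>E pcarrier M \<rightarrow>\<^sub>E Pow (pcarrier M)"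
    and pzero_in: "pzero M \<in> pcarrier M"
    and padd_pzero: "a \<in> pcarrier M \<Longrightarrow> a \<in> padd M (pzero M) a"
    and padd_commute: "\<lbrakk>a \<in> pcarrier M; b \<in> pcarrier M\<rbrakk> \<Longrightarrow> padd M a b = padd M b a"

definition plasma_hom :: "'a plasma \<Rightarrow> 'b plasma \<Rightarrow> ('a \<Rightarrow> 'b) set" where
  "plasma_hom M N =
    {f \<in> pcarrier M \<rightarrow>\<^sub>E pcarrier N. f (pzero M) = pzero N \<and>
      (\<forall>a\<in>pcarrier M. \<forall>b\<in>pcarrier M. f ` padd M a b \<subseteq> padd N (f a) (f b))}"

definition Plas :: "('a plasma, 'a \<Rightarrow> 'a) category" where
  "Plas =
    \<lparr>Obj = {M. plasma M},
     Hom = plasma_hom,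
     Idt = (\<lambda>M. \<lambda>x\<in>pcarrier M. x),
     Cmp = (\<lambda>M N P g f. compose (pcarrier M) g f)\<rparr>"


section \<open>The plasmic nerve\<close>

definition nerve_set :: "'a plasma \<Rightarrow> nat \<Rightarrow> (nat set \<Rightarrow> 'a) set" where
  "nerve_set M n =
    {x \<in> Pow {1..n} \<rightarrow>\<^sub>E pcarrier M. x {} = pzero M \<and>
      (\<forall>S\<subseteq>{1..n}. \<forall>T\<subseteq>{1..n}. S \<inter> T = {} \<longrightarrow> x (S \<union> T) \<in> padd M (x S) (x T))}"

definition nerve_pt :: "'a plasma \<Rightarrow> nat \<Rightarrow> (nat set \<Rightarrow> 'a) pointed" where
  "nerve_pt M n = (nerve_set M n, \<lambda>S\<in>Pow {1..n}. pzero M)"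

text \<open>For \<open>T \<subseteq> {1..m}\<close> the preimage below is contained in \<open>{1..n}\<close>, because \<open>\<phi> 0 = 0 \<notin> T\<close>.\<close>

definition nerve_map ::
  "'a plasma \<Rightarrow> nat \<Rightarrow> nat \<Rightarrow> (nat \<Rightarrow> nat) \<Rightarrow> (nat set \<Rightarrow> 'a) \<Rightarrow> (nat set \<Rightarrow> 'a)" where
  "nerve_map M n m \<phi> = (\<lambda>x\<in>nerve_set M n. \<lambda>T\<in>Pow {1..m}. x {i \<in> {..n}. \<phi> i \<in> T})"

definition nerve_obj :: "'a plasma \<Rightarrow> (nat set \<Rightarrow> 'a) F1_functor" where
  "nerve_obj M =
    \<lparr>fob = nerve_pt M,
     fmor = (\<lambda>n m. \<lambda>\<phi>\<in>Hom Fin_pt n m. nerve_map M n m \<phi>)\<rparr>"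

definition nerve_mor :: "'a plasma \<Rightarrow> ('a \<Rightarrow> 'a) \<Rightarrow> nat \<Rightarrow> (nat set \<Rightarrow> 'a) \<Rightarrow> (nat set \<Rightarrow> 'a)" where
  "nerve_mor M f = (\<lambda>n. \<lambda>x\<in>nerve_set M n. \<lambda>S\<in>Pow {1..n}. f (x S))"

definition plasmic_nerve ::
  "('a plasma, 'a \<Rightarrow> 'a, (nat set \<Rightarrow> 'a) F1_functor, nat \<Rightarrow> (nat set \<Rightarrow> 'a) \<Rightarrow> (nat set \<Rightarrow> 'a)) cfunctor"
  where
  "plasmic_nerve =
    \<lparr>fob = (\<lambda>M\<in>Obj Plas. nerve_obj M),
     fmor = (\<lambda>M\<in>Obj Plas. \<lambda>N\<in>Obj Plas. \<lambda>f\<in>Hom Plas M N. nerve_mor M f)\<rparr>"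

end

theory Submission
  imports Defs
begin

text \<open>
  Level \<open>1\<close> of the nerve of a plasma \<open>M\<close> is \<open>M\<close> itself: a family indexed by the subsets of \<open>{1}\<close>
  is determined by its value at \<open>{1}\<close>, and the unit law and commutativity make every value
  possible (\<open>singleton_family_in_nerve\<close>). Level \<open>2\<close> is the set of triples \<open>(a, b, c)\<close> with
  \<open>c \<in> a \<boxplus> b\<close>, that is, the graph of the hyperaddition (\<open>sum_family_in_nerve\<close>). Every level
  embeds into a power of level \<open>1\<close>: the component of a family at \<open>S\<close> is its image under the
  pointed map \<open>{0, \<dots>, n} \<rightarrow> {0, 1}\<close> that sends \<open>S\<close> to \<open>1\<close> and everything else to \<open>0\<close>
  (\<open>nerve_map_char_map\<close>).

  Naturality along these maps forces a transformation \<open>\<alpha>\<close> between nerves to be applied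
  componentwise, through the function \<open>f\<close> that \<open>\<alpha>\<close> induces on level \<open>1\<close>
  (\<open>nat_trans_componentwise\<close>). Hence \<open>\<alpha>\<close> and \<open>f\<close> determine each other. That \<open>f\<close> preserves the
  unit is the pointedness of \<open>\<alpha>\<close> on level \<open>1\<close>, and that it is compatible with \<open>\<boxplus>\<close> is the existence
  of \<open>\<alpha>\<close> on level \<open>2\<close> (\<open>level_one_map_in_plasma_hom\<close>).
\<close>

section \<open>The categories involved\<close>

lemma category_functor_category:
  fixes C :: "('o, 'm) category" and D :: "('p, 'n) category"
  assumes "category D"
  shows "category (functor_category C D)"
proof -
  interpret D: category D by fact
  have obj: "fob F X \<in> Obj D" if "cfunctor C D F" "X \<in> Obj C" for F X
    using that cfunctor.fob_type by fastforce
  have mor: "fmor F X Y f \<in> Hom D (fob F X) (fob F Y)"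
    if "cfunctor C D F" "X \<in> Obj C" "Y \<in> Obj C" "f \<in> Hom C X Y" for F X Y f
    using PiE_mem[OF PiE_mem[OF PiE_mem[OF cfunctor.fmor_type[OF that(1)] that(2)] that(3)] that(4)] .
  have comp: "\<alpha> X \<in> Hom D (fob F X) (fob G X)"
    if "\<alpha> \<in> nat_transformations C D F G" "X \<in> Obj C" for \<alpha> F G X
    using that by (auto simp: nat_transformations_def)
  have nat: "Cmp D (fob F X) (fob F Y) (fob G Y) (\<alpha> Y) (fmor F X Y f)
      = Cmp D (fob F X) (fob G X) (fob G Y) (fmor G X Y f) (\<alpha> X)"
    if "\<alpha> \<in> nat_transformations C D F G" "X \<in> Obj C" "Y \<in> Obj C" "f \<in> Hom C X Y" for \<alpha> F G X Y f
    using that by (auto simp: nat_transformations_def)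
  have ext: "\<alpha> \<in> extensional (Obj C)" if "\<alpha> \<in> nat_transformations C D F G" for \<alpha> F G
    using that by (auto simp: nat_transformations_def PiE_def)
  show ?thesis
  proof
    fix F assume "F \<in> Obj (functor_category C D)"
    then have F: "cfunctor C D F" by (simp add: functor_category_def)
    show "Idt (functor_category C D) F \<in> Hom (functor_category C D) F F"
      using F by (auto simp: functor_category_def nat_transformations_def obj mor
          D.Idt_in_Hom D.Cmp_Idt_left D.Cmp_Idt_right)
  next
    fix F G H \<alpha> \<beta>
    assume "F \<in> Obj (functor_category C D)" "G \<in> Obj (functor_category C D)"
      "H \<in> Obj (functor_category C D)" "\<alpha> \<in> Hom (functor_category C D) F G"
      "\<beta> \<in> Hom (functor_category C D) G H"
    then have F: "cfunctor C D F" and G: "cfunctor C D G" and H: "cfunctor C D H"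
      and \<alpha>: "\<alpha> \<in> nat_transformations C D F G" and \<beta>: "\<beta> \<in> nat_transformations C D G H"
      by (simp_all add: functor_category_def)
    have "Cmp D (fob F X) (fob F Y) (fob H Y)
           (Cmp D (fob F Y) (fob G Y) (fob H Y) (\<beta> Y) (\<alpha> Y)) (fmor F X Y f)
        = Cmp D (fob F X) (fob H X) (fob H Y) (fmor H X Y f)
           (Cmp D (fob F X) (fob G X) (fob H X) (\<beta> X) (\<alpha> X))"
      if XY: "X \<in> Obj C" "Y \<in> Obj C" and f: "f \<in> Hom C X Y" for X Y f
    proof -
      note objs = obj[OF F XY(1)] obj[OF F XY(2)] obj[OF G XY(1)] obj[OF G XY(2)]
        obj[OF H XY(1)] obj[OF H XY(2)]
      note mors = mor[OF F XY f] mor[OF G XY f] mor[OF H XY f]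
        comp[OF \<alpha> XY(1)] comp[OF \<alpha> XY(2)] comp[OF \<beta> XY(1)] comp[OF \<beta> XY(2)]
      \<comment> \<open>The naturality squares of \<open>\<alpha>\<close> and \<open>\<beta>\<close> at \<open>f\<close>, pasted along \<open>G f\<close>.\<close>
      show ?thesis
        using D.Cmp_assoc[OF objs(1,2,4,6) mors(1,5,7)] D.Cmp_assoc[OF objs(1,3,4,6) mors(4,2,7)]
          D.Cmp_assoc[OF objs(1,3,5,6) mors(4,6,3)] nat[OF \<alpha> XY f] nat[OF \<beta> XY f]
        by simp
    qed
    then show "Cmp (functor_category C D) F G H \<beta> \<alpha> \<in> Hom (functor_category C D) F H"
      using obj[OF F] obj[OF G] obj[OF H] comp[OF \<alpha>] comp[OF \<beta>]
      by (auto simp: functor_category_def nat_transformations_def D.Cmp_in_Hom)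
  next
    fix F G \<alpha>
    assume "F \<in> Obj (functor_category C D)" "G \<in> Obj (functor_category C D)"
      "\<alpha> \<in> Hom (functor_category C D) F G"
    then have F: "cfunctor C D F" and G: "cfunctor C D G"
      and \<alpha>: "\<alpha> \<in> nat_transformations C D F G"
      by (simp_all add: functor_category_def)
    show "Cmp (functor_category C D) F G G (Idt (functor_category C D) G) \<alpha> = \<alpha>"
      using obj[OF F] obj[OF G] comp[OF \<alpha>] extensional_arb[OF ext[OF \<alpha>]]
      by (auto simp: functor_category_def fun_eq_iff restrict_def D.Cmp_Idt_left)
    show "Cmp (functor_category C D) F F G \<alpha> (Idt (functor_category C D) F) = \<alpha>"
      using obj[OF F] obj[OF G] comp[OF \<alpha>] extensional_arb[OF ext[OF \<alpha>]]
      by (auto simp: functor_category_def fun_eq_iff restrict_def D.Cmp_Idt_right)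
  next
    fix E F G H \<alpha> \<beta> \<gamma>
    assume "E \<in> Obj (functor_category C D)" "F \<in> Obj (functor_category C D)"
      "G \<in> Obj (functor_category C D)" "H \<in> Obj (functor_category C D)"
      "\<alpha> \<in> Hom (functor_category C D) E F" "\<beta> \<in> Hom (functor_category C D) F G"
      "\<gamma> \<in> Hom (functor_category C D) G H"
    then show "Cmp (functor_category C D) E G H \<gamma> (Cmp (functor_category C D) E F G \<beta> \<alpha>)
        = Cmp (functor_category C D) E F H (Cmp (functor_category C D) F G H \<gamma> \<beta>) \<alpha>"
      by (auto simp: functor_category_def fun_eq_iff restrict_def intro!: D.Cmp_assoc obj comp)
  qed
qed

lemma category_full_subcategory:
  assumes "category C"
  shows "category (full_subcategory C P)"
proof -
  interpret category C by fact
  show ?thesis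
    by unfold_locales
      (auto simp: full_subcategory_def Idt_in_Hom Cmp_in_Hom Cmp_Idt_left Cmp_Idt_right
        intro: Cmp_assoc)
qed

lemma category_Set_pt: "category Set_pt"
  by unfold_locales
    (auto simp: Set_pt_def compose_def fun_eq_iff restrict_def PiE_iff extensional_def)

lemma category_Fin_pt: "category Fin_pt"
  by unfold_locales
    (auto simp: Fin_pt_def Set_pt_def compose_def fun_eq_iff restrict_def PiE_iff extensional_def)

lemma category_Mod_F1: "category Mod_F1"
  unfolding Mod_F1_def
  by (intro category_full_subcategory category_functor_category category_Set_pt)

lemma plasma_padd_closed:
  assumes "plasma M" "a \<in> pcarrier M" "b \<in> pcarrier M" "c \<in> padd M a b"
  shows "c \<in> pcarrier M"
  using PiE_mem[OF PiE_mem[OF plasma.padd_type[OF assms(1)] assms(2)] assms(3)] assms(4) by auto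

lemma plasma_homI:
  assumes "f \<in> extensional (pcarrier M)"
    and "\<And>a. a \<in> pcarrier M \<Longrightarrow> f a \<in> pcarrier N"
    and "f (pzero M) = pzero N"
    and "\<And>a b c. \<lbrakk>a \<in> pcarrier M; b \<in> pcarrier M; c \<in> padd M a b\<rbrakk> \<Longrightarrow> f c \<in> padd N (f a) (f b)"
  shows "f \<in> plasma_hom M N"
  unfolding plasma_hom_def PiE_iff using assms by blast

lemma plasma_hom_mem: "f \<in> plasma_hom M N \<Longrightarrow> a \<in> pcarrier M \<Longrightarrow> f a \<in> pcarrier N"
  by (auto simp: plasma_hom_def)

lemma plasma_hom_zero: "f \<in> plasma_hom M N \<Longrightarrow> f (pzero M) = pzero N"
  by (simp add: plasma_hom_def)

lemma plasma_hom_padd: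
  "\<lbrakk>f \<in> plasma_hom M N; a \<in> pcarrier M; b \<in> pcarrier M; c \<in> padd M a b\<rbrakk>
    \<Longrightarrow> f c \<in> padd N (f a) (f b)"
  unfolding plasma_hom_def by blast

lemma plasma_hom_arb: "f \<in> plasma_hom M N \<Longrightarrow> a \<notin> pcarrier M \<Longrightarrow> f a = undefined"
  by (auto simp: plasma_hom_def)

lemma category_Plas: "category Plas"
proof
  fix M :: "'a plasma" assume "M \<in> Obj Plas"
  then show "Idt Plas M \<in> Hom Plas M M"
    by (auto simp: Plas_def plasma_hom_def plasma.pzero_in dest: plasma_padd_closed)
next
  fix M N P :: "'a plasma" and f g
  assume "M \<in> Obj Plas" and f: "f \<in> Hom Plas M N" and g: "g \<in> Hom Plas N P"
  then have M: "plasma M" and f: "f \<in> plasma_hom M N" and g: "g \<in> plasma_hom N P"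
    by (simp_all add: Plas_def)
  have "compose (pcarrier M) g f \<in> plasma_hom M P"
  proof (rule plasma_homI)
    show "compose (pcarrier M) g f c
        \<in> padd P (compose (pcarrier M) g f a) (compose (pcarrier M) g f b)"
      if a: "a \<in> pcarrier M" and b: "b \<in> pcarrier M" and c: "c \<in> padd M a b" for a b c
      using plasma_hom_padd[OF g plasma_hom_mem[OF f a] plasma_hom_mem[OF f b]
          plasma_hom_padd[OF f a b c]] a b plasma_padd_closed[OF M a b c]
      by (simp add: compose_def)
  qed (simp_all add: compose_def plasma.pzero_in[OF M] plasma_hom_mem[OF f] plasma_hom_mem[OF g]
      plasma_hom_zero[OF f] plasma_hom_zero[OF g])
  then show "Cmp Plas M N P g f \<in> Hom Plas M P"
    by (simp add: Plas_def)
next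
  fix M N :: "'a plasma" and f
  assume "M \<in> Obj Plas" "N \<in> Obj Plas" "f \<in> Hom Plas M N"
  then have f: "f \<in> pcarrier M \<rightarrow>\<^sub>E pcarrier N"
    by (simp add: Plas_def plasma_hom_def)
  show "Cmp Plas M N N (Idt Plas N) f = f"
    using f by (auto simp: Plas_def PiE_def intro: Id_compose)
  show "Cmp Plas M M N f (Idt Plas M) = f"
    using f by (auto simp: Plas_def PiE_def intro: compose_Id)
next
  fix L M N P :: "'a plasma" and f g h
  assume "f \<in> Hom Plas L M"
  then have "f \<in> pcarrier L \<rightarrow> pcarrier M"
    by (auto simp: Plas_def plasma_hom_def)
  then show "Cmp Plas L N P h (Cmp Plas L M N g f) = Cmp Plas L M P (Cmp Plas M N P h g) f"
    by (simp add: Plas_def compose_assoc)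
qed

section \<open>The plasmic nerve as a functor\<close>

lemma nerve_setI:
  assumes "\<And>S. S \<subseteq> {1..n} \<Longrightarrow> x S \<in> pcarrier M"
    and "x \<in> extensional (Pow {1..n})"
    and "x {} = pzero M"
    and "\<And>S T. \<lbrakk>S \<subseteq> {1..n}; T \<subseteq> {1..n}; S \<inter> T = {}\<rbrakk> \<Longrightarrow> x (S \<union> T) \<in> padd M (x S) (x T)"
  shows "x \<in> nerve_set M n"
  using assms by (auto simp: nerve_set_def PiE_iff)

lemma nerve_set_mem: "x \<in> nerve_set M n \<Longrightarrow> S \<subseteq> {1..n} \<Longrightarrow> x S \<in> pcarrier M"
  by (auto simp: nerve_set_def)

lemma nerve_set_arb: "x \<in> nerve_set M n \<Longrightarrow> \<not> S \<subseteq> {1..n} \<Longrightarrow> x S = undefined"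
  by (auto simp: nerve_set_def)

lemma nerve_set_empty: "x \<in> nerve_set M n \<Longrightarrow> x {} = pzero M"
  by (simp add: nerve_set_def)

lemma nerve_set_padd:
  "\<lbrakk>x \<in> nerve_set M n; S \<subseteq> {1..n}; T \<subseteq> {1..n}; S \<inter> T = {}\<rbrakk>
    \<Longrightarrow> x (S \<union> T) \<in> padd M (x S) (x T)"
  by (simp add: nerve_set_def)

lemma nerve_pt_in_Obj: "plasma M \<Longrightarrow> nerve_pt M n \<in> Obj Set_pt"
  by (auto simp: nerve_pt_def Set_pt_def plasma.pzero_in plasma.padd_pzero intro!: nerve_setI)

lemma Hom_Fin_pt_iff: "\<phi> \<in> Hom Fin_pt n m \<longleftrightarrow> \<phi> \<in> {..n} \<rightarrow>\<^sub>E {..m} \<and> \<phi> 0 = 0"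
  by (auto simp: Fin_pt_def Set_pt_def)

lemma Hom_Set_pt_nerve_iff:
  "F \<in> Hom Set_pt (nerve_pt M n) (nerve_pt N m) \<longleftrightarrow>
    F \<in> nerve_set M n \<rightarrow>\<^sub>E nerve_set N m \<and>
    F (\<lambda>S\<in>Pow {1..n}. pzero M) = (\<lambda>S\<in>Pow {1..m}. pzero N)"
  by (auto simp: nerve_pt_def Set_pt_def)

lemma pointed_preimage_subset:
  fixes \<phi> :: "nat \<Rightarrow> nat"
  assumes "\<phi> 0 = 0" "T \<subseteq> {1..m}"
  shows "{i \<in> {..n}. \<phi> i \<in> T} \<subseteq> {1..n}"
proof
  fix i assume "i \<in> {i \<in> {..n}. \<phi> i \<in> T}"
  with assms show "i \<in> {1..n}" by (cases "i = 0") auto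
qed

lemma nerve_map_in_nerve_set:
  assumes \<phi>: "\<phi> \<in> Hom Fin_pt n m" and x: "x \<in> nerve_set M n"
  shows "nerve_map M n m \<phi> x \<in> nerve_set M m"
proof (rule nerve_setI)
  have \<phi>0: "\<phi> 0 = 0" using \<phi> by (simp add: Hom_Fin_pt_iff)
  note sub = pointed_preimage_subset[of \<phi>, OF \<phi>0]
  show "nerve_map M n m \<phi> x T \<in> pcarrier M" if "T \<subseteq> {1..m}" for T
    using x that nerve_set_mem[OF x sub[OF that]] by (simp add: nerve_map_def)
  show "nerve_map M n m \<phi> x {} = pzero M"
    using x nerve_set_empty[OF x] by (simp add: nerve_map_def)
  show "nerve_map M n m \<phi> x (S \<union> T) \<in> padd M (nerve_map M n m \<phi> x S) (nerve_map M n m \<phi> x T)"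
    if S: "S \<subseteq> {1..m}" and T: "T \<subseteq> {1..m}" and disj: "S \<inter> T = {}" for S T
  proof -
    have "{i \<in> {..n}. \<phi> i \<in> S} \<inter> {i \<in> {..n}. \<phi> i \<in> T} = {}"
      using disj by auto
    moreover have "{i \<in> {..n}. \<phi> i \<in> S \<union> T} = {i \<in> {..n}. \<phi> i \<in> S} \<union> {i \<in> {..n}. \<phi> i \<in> T}"
      by auto
    ultimately show ?thesis
      using x S T nerve_set_padd[OF x sub[OF S] sub[OF T]] by (simp add: nerve_map_def)
  qed
qed (use x in \<open>simp add: nerve_map_def\<close>)

lemma nerve_map_in_Hom:
  assumes "plasma M" "\<phi> \<in> Hom Fin_pt n m"
  shows "nerve_map M n m \<phi> \<in> Hom Set_pt (nerve_pt M n) (nerve_pt M m)"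
proof -
  have zero: "(\<lambda>S\<in>Pow {1..n}. pzero M) \<in> nerve_set M n"
    using nerve_pt_in_Obj[OF assms(1), of n] by (simp add: nerve_pt_def Set_pt_def)
  have "\<phi> 0 = 0"
    using assms(2) by (simp add: Hom_Fin_pt_iff)
  from pointed_preimage_subset[of \<phi>, OF this]
  have "nerve_map M n m \<phi> (\<lambda>S\<in>Pow {1..n}. pzero M) = (\<lambda>S\<in>Pow {1..m}. pzero M)"
    using zero by (auto simp: nerve_map_def fun_eq_iff)
  moreover have "nerve_map M n m \<phi> \<in> extensional (nerve_set M n)"
    by (simp add: nerve_map_def)
  ultimately show ?thesis
    using nerve_map_in_nerve_set[OF assms(2)]
    by (auto simp: Hom_Set_pt_nerve_iff PiE_iff)
qed

lemma nerve_map_id: "nerve_map M n n (\<lambda>i\<in>{..n}. i) = (\<lambda>x\<in>nerve_set M n. x)"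
proof -
  have "{i \<in> {..n}. (\<lambda>i\<in>{..n}. i) i \<in> T} = T" if "T \<subseteq> {1..n}" for T
    using that by auto
  then show ?thesis
    by (auto simp: nerve_map_def fun_eq_iff restrict_def nerve_set_arb)
qed

text \<open>Functoriality holds because preimages compose contravariantly.\<close>

lemma nerve_map_compose:
  assumes \<phi>: "\<phi> \<in> Hom Fin_pt n m" and \<psi>: "\<psi> \<in> Hom Fin_pt m k"
  shows "nerve_map M n k (compose {..n} \<psi> \<phi>)
    = compose (nerve_set M n) (nerve_map M m k \<psi>) (nerve_map M n m \<phi>)"
proof
  fix x
  show "nerve_map M n k (compose {..n} \<psi> \<phi>) x
    = compose (nerve_set M n) (nerve_map M m k \<psi>) (nerve_map M n m \<phi>) x"
  proof (cases "x \<in> nerve_set M n")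
    case x: True
    have "{i \<in> {..n}. \<phi> i \<in> {j \<in> {..m}. \<psi> j \<in> T}} = {i \<in> {..n}. compose {..n} \<psi> \<phi> i \<in> T}" for T
      using \<phi> by (auto simp: compose_def Hom_Fin_pt_iff)
    moreover have "{j \<in> {..m}. \<psi> j \<in> T} \<subseteq> {1..m}" if "T \<subseteq> {1..k}" for T
      using \<psi> that pointed_preimage_subset by (simp add: Hom_Fin_pt_iff)
    ultimately have "nerve_map M n k (compose {..n} \<psi> \<phi>) x T
        = nerve_map M m k \<psi> (nerve_map M n m \<phi> x) T" for T
      using x nerve_map_in_nerve_set[OF \<phi> x] by (simp add: nerve_map_def)
    with x show ?thesis
      by (auto simp: compose_def)
  qed (simp add: nerve_map_def compose_def)
qed

lemma nerve_obj_functor: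
  assumes "plasma M"
  shows "cfunctor Fin_pt Set_pt (nerve_obj M)"
proof (intro cfunctor.intro cfunctor_axioms.intro category_Fin_pt category_Set_pt)
  show "fob (nerve_obj M) \<in> Obj Fin_pt \<rightarrow>\<^sub>E Obj Set_pt"
    using nerve_pt_in_Obj[OF assms] by (auto simp: nerve_obj_def Fin_pt_def)
  show "fmor (nerve_obj M) \<in> (\<Pi>\<^sub>E n\<in>Obj Fin_pt. \<Pi>\<^sub>E m\<in>Obj Fin_pt.
      Hom Fin_pt n m \<rightarrow>\<^sub>E Hom Set_pt (fob (nerve_obj M) n) (fob (nerve_obj M) m))"
    using nerve_map_in_Hom[OF assms]
    by (auto simp: nerve_obj_def PiE_iff extensional_def Fin_pt_def)
next
  fix n assume n: "n \<in> Obj Fin_pt"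
  then have "Idt Fin_pt n \<in> Hom Fin_pt n n"
    by (rule category.Idt_in_Hom[OF category_Fin_pt])
  then show "fmor (nerve_obj M) n n (Idt Fin_pt n) = Idt Set_pt (fob (nerve_obj M) n)"
    by (simp add: nerve_obj_def) (simp add: Fin_pt_def Set_pt_def nerve_map_id nerve_pt_def)
next
  fix n m k \<phi> \<psi>
  assume "n \<in> Obj Fin_pt" "m \<in> Obj Fin_pt" "k \<in> Obj Fin_pt"
    and \<phi>: "\<phi> \<in> Hom Fin_pt n m" and \<psi>: "\<psi> \<in> Hom Fin_pt m k"
  then have "Cmp Fin_pt n m k \<psi> \<phi> \<in> Hom Fin_pt n k"
    by (rule category.Cmp_in_Hom[OF category_Fin_pt])
  moreover have "Cmp Fin_pt n m k \<psi> \<phi> = compose {..n} \<psi> \<phi>"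
    by (simp add: Fin_pt_def Set_pt_def)
  ultimately show "fmor (nerve_obj M) n k (Cmp Fin_pt n m k \<psi> \<phi>)
      = Cmp Set_pt (fob (nerve_obj M) n) (fob (nerve_obj M) m) (fob (nerve_obj M) k)
          (fmor (nerve_obj M) m k \<psi>) (fmor (nerve_obj M) n m \<phi>)"
    using \<phi> \<psi> by (simp add: nerve_obj_def nerve_map_compose Set_pt_def nerve_pt_def)
qed

lemma nerve_obj_in_Mod_F1:
  assumes "plasma M"
  shows "nerve_obj M \<in> Obj Mod_F1"
proof -
  have "x = (\<lambda>S\<in>Pow {1..0}. pzero M)" if "x \<in> nerve_set M 0" for x
    using nerve_set_empty[OF that] nerve_set_arb[OF that] by (auto simp: fun_eq_iff restrict_def)
  moreover have "(\<lambda>S\<in>Pow {1..0}. pzero M) \<in> nerve_set M 0"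
    using nerve_pt_in_Obj[OF assms, of 0] by (simp add: nerve_pt_def Set_pt_def)
  ultimately have "is_singleton (nerve_set M 0)"
    by (auto simp: is_singleton_def)
  with nerve_obj_functor[OF assms] show ?thesis
    by (simp add: Mod_F1_def full_subcategory_def functor_category_def nerve_obj_def nerve_pt_def)
qed

text \<open>Two composites in \<open>Set_pt\<close> are restricted to the same domain, so the naturality squares may be
  checked elementwise; this frees the later arguments from the functor-category encoding.\<close>

lemma Hom_Mod_F1_nerve_iff:
  assumes "plasma M" "plasma N"
  shows "\<alpha> \<in> Hom Mod_F1 (nerve_obj M) (nerve_obj N) \<longleftrightarrow>
    (\<forall>n. \<alpha> n \<in> nerve_set M n \<rightarrow>\<^sub>E nerve_set N n
        \<and> \<alpha> n (\<lambda>S\<in>Pow {1..n}. pzero M) = (\<lambda>S\<in>Pow {1..n}. pzero N)) \<and>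
    (\<forall>n m. \<forall>\<phi>\<in>Hom Fin_pt n m. \<forall>x\<in>nerve_set M n.
        \<alpha> m (nerve_map M n m \<phi> x) = nerve_map N n m \<phi> (\<alpha> n x))"
proof -
  have Obj: "Obj Fin_pt = UNIV"
    by (simp add: Fin_pt_def)
  have Cmp: "Cmp Set_pt (nerve_pt M n) Y Z g f = compose (nerve_set M n) g f" for n Y Z g f
    by (simp add: Set_pt_def nerve_pt_def)
  have eq: "compose A g f = compose A g' f' \<longleftrightarrow> (\<forall>x\<in>A. g (f x) = g' (f' x))"
    for A and f g f' g' :: "(nat set \<Rightarrow> 'a) \<Rightarrow> (nat set \<Rightarrow> 'a)"
    by (auto simp: compose_def fun_eq_iff restrict_def)
  show ?thesis
    by (simp add: Mod_F1_def full_subcategory_def functor_category_def nat_transformations_def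
        nerve_obj_def Obj PiE_UNIV_domain Pi_iff Hom_Set_pt_nerve_iff Cmp eq cong: ball_cong)
qed

lemma nerve_mor_in_nerve_set:
  assumes f: "f \<in> plasma_hom M N" and x: "x \<in> nerve_set M n"
  shows "nerve_mor M f n x \<in> nerve_set N n"
proof (rule nerve_setI)
  show "nerve_mor M f n x (S \<union> T) \<in> padd N (nerve_mor M f n x S) (nerve_mor M f n x T)"
    if "S \<subseteq> {1..n}" "T \<subseteq> {1..n}" "S \<inter> T = {}" for S T
    using x that plasma_hom_padd[OF f nerve_set_mem[OF x that(1)] nerve_set_mem[OF x that(2)]
        nerve_set_padd[OF x that]]
    by (simp add: nerve_mor_def)
  show "nerve_mor M f n x S \<in> pcarrier N" if "S \<subseteq> {1..n}" for S
    using x that plasma_hom_mem[OF f nerve_set_mem[OF x that]] by (simp add: nerve_mor_def)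
qed (use x in \<open>simp_all add: nerve_mor_def nerve_set_empty plasma_hom_zero[OF f]\<close>)

lemma nerve_mor_in_Hom:
  assumes M: "plasma M" and N: "plasma N" and f: "f \<in> plasma_hom M N"
  shows "nerve_mor M f \<in> Hom Mod_F1 (nerve_obj M) (nerve_obj N)"
proof -
  have zero: "(\<lambda>S\<in>Pow {1..n}. pzero M) \<in> nerve_set M n" for n
    using nerve_pt_in_Obj[OF M, of n] by (simp add: nerve_pt_def Set_pt_def)
  have "nerve_mor M f n (\<lambda>S\<in>Pow {1..n}. pzero M) = (\<lambda>S\<in>Pow {1..n}. pzero N)" for n
    using zero by (auto simp: nerve_mor_def fun_eq_iff plasma_hom_zero[OF f])
  moreover have "nerve_mor M f m (nerve_map M n m \<phi> x) = nerve_map N n m \<phi> (nerve_mor M f n x)"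
    if \<phi>: "\<phi> \<in> Hom Fin_pt n m" and x: "x \<in> nerve_set M n" for n m \<phi> x
  proof -
    have "\<phi> 0 = 0"
      using \<phi> by (simp add: Hom_Fin_pt_iff)
    from pointed_preimage_subset[of \<phi>, OF this] show ?thesis
      using x nerve_map_in_nerve_set[OF \<phi> x] nerve_mor_in_nerve_set[OF f x]
      by (auto simp: nerve_mor_def nerve_map_def fun_eq_iff)
  qed
  moreover have "nerve_mor M f n \<in> nerve_set M n \<rightarrow>\<^sub>E nerve_set N n" for n
    using nerve_mor_in_nerve_set[OF f] by (auto simp: nerve_mor_def)
  ultimately show ?thesis
    by (simp add: Hom_Mod_F1_nerve_iff[OF M N])
qed

lemma plasmic_nerve_functor: "cfunctor Plas Mod_F1 plasmic_nerve"
proof (intro cfunctor.intro cfunctor_axioms.intro category_Plas category_Mod_F1)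
  show "fob plasmic_nerve \<in> Obj Plas \<rightarrow>\<^sub>E Obj Mod_F1"
    using nerve_obj_in_Mod_F1 by (auto simp: plasmic_nerve_def Plas_def)
  show "fmor plasmic_nerve \<in> (\<Pi>\<^sub>E M\<in>Obj Plas. \<Pi>\<^sub>E N\<in>Obj Plas.
      Hom Plas M N \<rightarrow>\<^sub>E Hom Mod_F1 (fob plasmic_nerve M) (fob plasmic_nerve N))"
    using nerve_mor_in_Hom
    by (auto simp: plasmic_nerve_def Plas_def PiE_iff extensional_def)
next
  fix M :: "'a plasma" assume M: "M \<in> Obj Plas"
  then have "Idt Plas M \<in> Hom Plas M M"
    by (rule category.Idt_in_Hom[OF category_Plas])
  moreover have "nerve_mor M (\<lambda>a\<in>pcarrier M. a) n = (\<lambda>x\<in>nerve_set M n. x)" for n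
    by (auto simp: nerve_mor_def fun_eq_iff restrict_def nerve_set_arb nerve_set_mem)
  ultimately show "fmor plasmic_nerve M M (Idt Plas M) = Idt Mod_F1 (fob plasmic_nerve M)"
    using M by (simp add: plasmic_nerve_def)
      (simp add: Plas_def Mod_F1_def full_subcategory_def functor_category_def nerve_obj_def
        nerve_pt_def Fin_pt_def Set_pt_def fun_eq_iff)
next
  fix M N P :: "'a plasma" and f g
  assume obj: "M \<in> Obj Plas" "N \<in> Obj Plas" "P \<in> Obj Plas"
    and mor: "f \<in> Hom Plas M N" "g \<in> Hom Plas N P"
  then have gf: "Cmp Plas M N P g f \<in> Hom Plas M P"
    by (rule category.Cmp_in_Hom[OF category_Plas])
  have f: "f \<in> plasma_hom M N"
    using mor by (simp add: Plas_def)
  have "nerve_mor M (compose (pcarrier M) g f) n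
      = compose (nerve_set M n) (nerve_mor N g n) (nerve_mor M f n)" for n
    using nerve_mor_in_nerve_set[OF f, of _ n]
    by (auto simp: nerve_mor_def compose_def fun_eq_iff restrict_def nerve_set_mem)
  then show "fmor plasmic_nerve M P (Cmp Plas M N P g f)
      = Cmp Mod_F1 (fob plasmic_nerve M) (fob plasmic_nerve N) (fob plasmic_nerve P)
          (fmor plasmic_nerve N P g) (fmor plasmic_nerve M N f)"
    using obj mor gf by (simp add: plasmic_nerve_def)
      (simp add: Plas_def Mod_F1_def full_subcategory_def functor_category_def nerve_obj_def
        nerve_pt_def Fin_pt_def Set_pt_def fun_eq_iff)
qed

section \<open>Full faithfulness\<close>

definition singleton_family :: "'a plasma \<Rightarrow> 'a \<Rightarrow> nat set \<Rightarrow> 'a" where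
  "singleton_family M a = (\<lambda>S\<in>Pow {1..1}. if 1 \<in> S then a else pzero M)"

definition sum_family :: "'a plasma \<Rightarrow> 'a \<Rightarrow> 'a \<Rightarrow> 'a \<Rightarrow> nat set \<Rightarrow> 'a" where
  "sum_family M a b c = (\<lambda>S\<in>Pow {1..2}.
    if 1 \<in> S then (if 2 \<in> S then c else a) else (if 2 \<in> S then b else pzero M))"

definition char_map :: "nat \<Rightarrow> nat set \<Rightarrow> nat \<Rightarrow> nat" where
  "char_map n S = (\<lambda>i\<in>{..n}. if i \<in> S then 1 else 0)"

definition level_one_map ::
  "'a plasma \<Rightarrow> (nat \<Rightarrow> (nat set \<Rightarrow> 'a) \<Rightarrow> (nat set \<Rightarrow> 'a)) \<Rightarrow> 'a \<Rightarrow> 'a" where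
  "level_one_map M \<alpha> = (\<lambda>a\<in>pcarrier M. \<alpha> 1 (singleton_family M a) {1})"

text \<open>The only disjoint pairs of subsets of \<open>{1}\<close> involve \<open>\<emptyset>\<close>, so the sum conditions reduce to the
  unit law and its mirror image.\<close>

lemma singleton_family_in_nerve:
  assumes "plasma M" "a \<in> pcarrier M"
  shows "singleton_family M a \<in> nerve_set M 1"
proof -
  have "a \<in> padd M a (pzero M)"
    using assms plasma.padd_pzero plasma.padd_commute plasma.pzero_in by metis
  then show ?thesis
    using assms plasma.pzero_in[OF assms(1)] plasma.padd_pzero[OF assms(1)]
    by (auto simp: singleton_family_def intro!: nerve_setI)
qed

text \<open>Among the disjoint pairs of subsets of \<open>{1, 2}\<close>, only \<open>{1}\<close> and \<open>{2}\<close> impose more than the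
  unit law, and they do so in both orders; commutativity makes the two conditions agree.\<close>

lemma sum_family_in_nerve:
  assumes "plasma M" "a \<in> pcarrier M" "b \<in> pcarrier M" "c \<in> padd M a b"
  shows "sum_family M a b c \<in> nerve_set M 2"
proof -
  have c: "c \<in> pcarrier M"
    using assms by (rule plasma_padd_closed)
  have swap: "c \<in> padd M b a"
    using assms plasma.padd_commute by metis
  have unit: "d \<in> padd M d (pzero M)" if "d \<in> pcarrier M" for d
    using that assms(1) plasma.padd_pzero plasma.padd_commute plasma.pzero_in by metis
  show ?thesis
    using assms c swap unit plasma.pzero_in[OF assms(1)] plasma.padd_pzero[OF assms(1)]
    by (auto simp: sum_family_def intro!: nerve_setI)
qed

lemma char_map_in_Hom:
  assumes "S \<subseteq> {1..n}"
  shows "char_map n S \<in> Hom Fin_pt n 1"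
  using assms by (auto simp: char_map_def Hom_Fin_pt_iff)

lemma nerve_map_char_map:
  assumes x: "x \<in> nerve_set M n" and S: "S \<subseteq> {1..n}"
  shows "nerve_map M n 1 (char_map n S) x = singleton_family M (x S)"
proof
  fix T
  have "{i \<in> {..n}. char_map n S i \<in> T} = (if 1 \<in> T then S else {})" if "T \<subseteq> {1..1}"
    using S that by (auto simp: char_map_def)
  then show "nerve_map M n 1 (char_map n S) x T = singleton_family M (x S) T"
    using x nerve_set_empty[OF x] by (auto simp: nerve_map_def singleton_family_def)
qed

text \<open>Naturality along the map to \<open>{0, 1}\<close> that singles out \<open>S\<close> computes the component at \<open>S\<close> on
  level \<open>1\<close>.\<close>

lemma nat_trans_componentwise:
  assumes M: "plasma M" and N: "plasma N"
    and \<alpha>: "\<alpha> \<in> Hom Mod_F1 (nerve_obj M) (nerve_obj N)"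
    and x: "x \<in> nerve_set M n" and S: "S \<subseteq> {1..n}"
  shows "\<alpha> n x S = level_one_map M \<alpha> (x S)"
proof -
  have \<alpha>x: "\<alpha> n x \<in> nerve_set N n"
    using \<alpha> x unfolding Hom_Mod_F1_nerve_iff[OF M N] by blast
  have "\<alpha> n x S = singleton_family N (\<alpha> n x S) {1}"
    by (simp add: singleton_family_def)
  also have "\<dots> = nerve_map N n 1 (char_map n S) (\<alpha> n x) {1}"
    using nerve_map_char_map[OF \<alpha>x S] by simp
  also have "\<dots> = \<alpha> 1 (nerve_map M n 1 (char_map n S) x) {1}"
    using \<alpha> x char_map_in_Hom[OF S] unfolding Hom_Mod_F1_nerve_iff[OF M N] by metis
  also have "\<dots> = level_one_map M \<alpha> (x S)"
    using nerve_map_char_map[OF x S] nerve_set_mem[OF x S] by (simp add: level_one_map_def)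
  finally show ?thesis .
qed

lemma level_one_map_in_plasma_hom:
  assumes M: "plasma M" and N: "plasma N"
    and \<alpha>: "\<alpha> \<in> Hom Mod_F1 (nerve_obj M) (nerve_obj N)"
  shows "level_one_map M \<alpha> \<in> plasma_hom M N"
proof -
  have mem: "\<alpha> n x \<in> nerve_set N n" if "x \<in> nerve_set M n" for n x
    using \<alpha> that unfolding Hom_Mod_F1_nerve_iff[OF M N] by blast
  have "level_one_map M \<alpha> a \<in> pcarrier N" if "a \<in> pcarrier M" for a
    using that nerve_set_mem[OF mem[OF singleton_family_in_nerve[OF M that]], of "{1}"]
    by (simp add: level_one_map_def)
  moreover have "level_one_map M \<alpha> (pzero M) = pzero N"
  proof -
    have "singleton_family M (pzero M) = (\<lambda>S\<in>Pow {1..1}. pzero M)"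
      by (simp add: singleton_family_def)
    moreover have "\<alpha> 1 (\<lambda>S\<in>Pow {1..1}. pzero M) = (\<lambda>S\<in>Pow {1..1}. pzero N)"
      using \<alpha> unfolding Hom_Mod_F1_nerve_iff[OF M N] by blast
    ultimately show ?thesis
      using plasma.pzero_in[OF M] by (simp add: level_one_map_def)
  qed
  moreover have "level_one_map M \<alpha> c \<in> padd N (level_one_map M \<alpha> a) (level_one_map M \<alpha> b)"
    if "a \<in> pcarrier M" "b \<in> pcarrier M" "c \<in> padd M a b" for a b c
  proof -
    let ?x = "sum_family M a b c"
    have x: "?x \<in> nerve_set M 2"
      using M that by (rule sum_family_in_nerve)
    \<comment> \<open>\<open>?x\<close> witnesses \<open>c \<in> a \<boxplus> b\<close> on level \<open>2\<close>; its image is such a witness in \<open>N\<close>.\<close>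
    have "\<alpha> 2 ?x ({1} \<union> {2}) \<in> padd N (\<alpha> 2 ?x {1}) (\<alpha> 2 ?x {2})"
      by (rule nerve_set_padd[OF mem[OF x]]) auto
    moreover have "?x {1} = a" "?x {2} = b" "?x ({1} \<union> {2}) = c"
      by (simp_all add: sum_family_def)
    moreover have "\<alpha> 2 ?x S = level_one_map M \<alpha> (?x S)" if "S \<subseteq> {1..2}" for S
      using M N \<alpha> x that by (rule nat_trans_componentwise)
    from this[of "{1}"] this[of "{2}"] this[of "{1} \<union> {2}"]
    have "\<alpha> 2 ?x {1} = level_one_map M \<alpha> (?x {1})"
      "\<alpha> 2 ?x {2} = level_one_map M \<alpha> (?x {2})"
      "\<alpha> 2 ?x ({1} \<union> {2}) = level_one_map M \<alpha> (?x ({1} \<union> {2}))"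
      by simp_all
    ultimately show ?thesis
      by metis
  qed
  moreover have "level_one_map M \<alpha> \<in> extensional (pcarrier M)"
    by (simp add: level_one_map_def)
  ultimately show ?thesis
    by (intro plasma_homI)
qed

lemma level_one_map_nerve_mor:
  assumes "plasma M" "f \<in> plasma_hom M N"
  shows "level_one_map M (nerve_mor M f) = f"
proof
  fix a
  show "level_one_map M (nerve_mor M f) a = f a"
    using plasma_hom_arb[OF assms(2)] singleton_family_in_nerve[OF assms(1), of a]
    by (cases "a \<in> pcarrier M") (auto simp: level_one_map_def nerve_mor_def singleton_family_def)
qed

lemma nerve_mor_level_one_map:
  assumes M: "plasma M" and N: "plasma N"
    and \<alpha>: "\<alpha> \<in> Hom Mod_F1 (nerve_obj M) (nerve_obj N)"
  shows "nerve_mor M (level_one_map M \<alpha>) = \<alpha>"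
proof (intro ext)
  fix n x S
  have \<alpha>n: "\<alpha> n \<in> nerve_set M n \<rightarrow>\<^sub>E nerve_set N n"
    using \<alpha> unfolding Hom_Mod_F1_nerve_iff[OF M N] by blast
  show "nerve_mor M (level_one_map M \<alpha>) n x S = \<alpha> n x S"
  proof (cases "x \<in> nerve_set M n")
    case True
    with nat_trans_componentwise[OF M N \<alpha> True] nerve_set_arb[OF PiE_mem[OF \<alpha>n True]]
    show ?thesis
      by (simp add: nerve_mor_def restrict_def)
  next
    case False
    with PiE_arb[OF \<alpha>n False] show ?thesis
      by (simp add: nerve_mor_def)
  qed
qed

theorem corollary3p15:
  shows "fully_faithful_functor
    (Plas :: ('a plasma, 'a \<Rightarrow> 'a) category)
    (Mod_F1 :: ((nat set \<Rightarrow> 'a) F1_functor, nat \<Rightarrow> (nat set \<Rightarrow> 'a) \<Rightarrow> (nat set \<Rightarrow> 'a)) category)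
    plasmic_nerve"
proof (intro fully_faithful_functor.intro fully_faithful_functor_axioms.intro
    plasmic_nerve_functor)
  fix M N :: "'a plasma"
  assume MN: "M \<in> Obj Plas" "N \<in> Obj Plas"
  then have M: "plasma M" and N: "plasma N"
    by (simp_all add: Plas_def)
  have Hom: "Hom Plas M N = plasma_hom M N"
    by (simp add: Plas_def)
  have "bij_betw (nerve_mor M) (plasma_hom M N) (Hom Mod_F1 (nerve_obj M) (nerve_obj N))"
    by (rule bij_betw_byWitness[where f' = "level_one_map M"])
      (auto simp: level_one_map_nerve_mor[OF M] nerve_mor_level_one_map[OF M N]
        intro: nerve_mor_in_Hom[OF M N] level_one_map_in_plasma_hom[OF M N])
  moreover have "bij_betw (fmor plasmic_nerve M N) (plasma_hom M N) B
      \<longleftrightarrow> bij_betw (nerve_mor M) (plasma_hom M N) B" for B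
    by (rule bij_betw_cong) (use MN Hom in \<open>simp add: plasmic_nerve_def\<close>)
  moreover have "fob plasmic_nerve M = nerve_obj M" "fob plasmic_nerve N = nerve_obj N"
    using MN by (simp_all add: plasmic_nerve_def)
  ultimately show "bij_betw (fmor plasmic_nerve M N) (Hom Plas M N)
      (Hom Mod_F1 (fob plasmic_nerve M) (fob plasmic_nerve N))"
    by (simp add: Hom)
qed

end
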